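(* Let $\mathbb{Y}$ be a closed proper subspace of a Banach space $\mathbb{X}$. Then $\mathbb{Y}$ is anti-coproximinal in $\mathbb{X}$ if $\overline{\mathrm{span}\,\mathcal{J}_{\mathbb{Y}}}^{w^*}=\mathbb{X}^*$. Moreover, when $Sm(\mathbb{X})\cap\mathbb{Y}$ is dense in $\mathbb{Y}$, then $\mathbb{Y}$ is anti-coproximinal in $\mathbb{X}$ if and only if $\overline{\mathrm{span}\,\mathcal{J}_{\mathbb{Y}}}^{w^*}=\mathbb{X}^*$.
   Context: Banach spaces are over $\mathbb{K}=\mathbb{R}$ or $\mathbb{C}$; $S_{\mathbb{X}}$ denotes the unit sphere of $\mathbb{X}$, $\mathbb{X}^*$ the dual space, and $\overline{A}^{w^*}$ the weak*-closure of $A\subset\mathbb{X}^*$. For nonzero $x\in\mathbb{X}$, $J(x)=\{x^*\in S_{\mathbb{X}^*}: x^*(x)=\|x\|\}$; a nonzero $x$ is smooth if $J(x)$ is a singleton, and $Sm(\mathbb{X})$ is the set of all smooth points of $\mathbb{X}$. For a subspace $\mathbb{Y}$ of $\mathbb{X}$, $\mathcal{J}_{\mathbb{Y}}=\{y^*\in S_{\mathbb{X}^*}: y^*(y)=1 \text{ for some } y\in Sm(\mathbb{X})\cap S_{\mathbb{Y}}\}$, with $\mathcal{J}_{\mathbb{Y}}=\emptyset$ if $Sm(\mathbb{X})\cap S_{\mathbb{Y}}=\emptyset$. For a subspace $\mathbb{Y}$ of $\mathbb{X}$ and $x\in\mathbb{X}$, $y_0\in\mathbb{Y}$ is a best coapproximation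 to $x$ out of $\mathbb{Y}$ if $\|y_0-y\|\le\|x-y\|$ for all $y\in\mathbb{Y}$. The subspace $\mathbb{Y}$ is anti-coproximinal in $\mathbb{X}$ if for every $x\in\mathbb{X}\setminus\mathbb{Y}$ there is no best coapproximation to $x$ out of $\mathbb{Y}$. *)

theory Defs
  imports "HOL-Analysis.Analysis" "HOL-Library.Function_Algebras"
begin

text \<open>
  The scalar fields: a real normed field that is either the real line or, with an imaginary
  unit and the usual modulus, the complex plane.  Up to isometric isomorphism over the reals,
  these two are the only members of the class.
\<close>

class real_or_complex = real_normed_field +
  assumes real_or_complex:
    "(\<forall>z. \<exists>a. z = a *\<^sub>R 1) \<or>
     (\<exists>i. i * i = - 1 \<and>
       (\<forall>z. \<exists>a b. z = a *\<^sub>R 1 + b *\<^sub>R i \<and> norm z = sqrt (a\<^sup>2 + b\<^sup>2)))"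

instance real :: real_or_complex
  by standard simp

instance complex :: real_or_complex
proof
  have "z = Re z *\<^sub>R 1 + Im z *\<^sub>R \<i> \<and> norm z = sqrt ((Re z)\<^sup>2 + (Im z)\<^sup>2)" for z
    by (simp add: complex_eq_iff cmod_def)
  then show "(\<forall>z::complex. \<exists>a. z = a *\<^sub>R 1) \<or>
     (\<exists>i. i * i = - 1 \<and>
       (\<forall>z::complex. \<exists>a b. z = a *\<^sub>R 1 + b *\<^sub>R i \<and> norm z = sqrt (a\<^sup>2 + b\<^sup>2)))"
    using i_squared by blast
qed

text \<open>
  A normed space over such a field \<open>'k\<close> is a real normed space together with a scalar
  multiplication by \<open>'k\<close> that extends the real one; completeness is added by taking the
  carrier type in class \<open>banach\<close>.
\<close>

locale normed_space_over = vector_space smul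
  for smul :: "'k::real_or_complex \<Rightarrow> 'a::real_normed_vector \<Rightarrow> 'a" +
  assumes scale_of_real: "smul (of_real r) x = r *\<^sub>R x"
    and norm_scale: "norm (smul c x) = norm c * norm x"

lemma normed_space_over_scaleR:
  "normed_space_over (scaleR :: real \<Rightarrow> 'a::real_normed_vector \<Rightarrow> 'a)"
  by unfold_locales (simp_all add: scaleR_right_distrib scaleR_left_distrib)

lemma normed_space_over_mult:
  "normed_space_over ((*) :: 'k::real_or_complex \<Rightarrow> 'k \<Rightarrow> 'k)"
  by unfold_locales (simp_all add: distrib_left distrib_right norm_mult scaleR_conv_of_real)

text \<open>
  The dual space is a set of functions; its norm is \<^const>\<open>onorm\<close>, its vector space
  operations are pointwise, and its weak* topology is that of pointwise convergence.
\<close>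

definition dual_space ::
    "('k::real_or_complex \<Rightarrow> 'a::real_normed_vector \<Rightarrow> 'a) \<Rightarrow> ('a \<Rightarrow> 'k) set" where
  "dual_space smul = {f. Vector_Spaces.linear smul (*) f \<and> bounded_linear f}"

definition dual_sphere ::
    "('k::real_or_complex \<Rightarrow> 'a::real_normed_vector \<Rightarrow> 'a) \<Rightarrow> ('a \<Rightarrow> 'k) set" where
  "dual_sphere smul = {f \<in> dual_space smul. onorm f = 1}"

definition dual_span :: "('a \<Rightarrow> 'k::real_or_complex) set \<Rightarrow> ('a \<Rightarrow> 'k) set" where
  "dual_span = module.span (\<lambda>c f x. c * f x)"

definition weak_star_topology ::
    "('k::real_or_complex \<Rightarrow> 'a::real_normed_vector \<Rightarrow> 'a) \<Rightarrow> ('a \<Rightarrow> 'k) topology" where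
  "weak_star_topology smul =
     subtopology (product_topology (\<lambda>_. euclidean) UNIV) (dual_space smul)"

definition support_functionals ::
    "('k::real_or_complex \<Rightarrow> 'a::real_normed_vector \<Rightarrow> 'a) \<Rightarrow> 'a \<Rightarrow> ('a \<Rightarrow> 'k) set" where
  "support_functionals smul x = {f \<in> dual_sphere smul. f x = of_real (norm x)}"

definition smooth_points ::
    "('k::real_or_complex \<Rightarrow> 'a::real_normed_vector \<Rightarrow> 'a) \<Rightarrow> 'a set" where
  "smooth_points smul = {x. x \<noteq> 0 \<and> (\<exists>f. support_functionals smul x = {f})}"

definition smooth_support_functionals ::
    "('k::real_or_complex \<Rightarrow> 'a::real_normed_vector \<Rightarrow> 'a) \<Rightarrow> 'a set \<Rightarrow> ('a \<Rightarrow> 'k) set" where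
  "smooth_support_functionals smul Y =
     {f \<in> dual_sphere smul. \<exists>y \<in> smooth_points smul \<inter> (sphere 0 1 \<inter> Y). f y = 1}"

definition best_coapproximation :: "'a::real_normed_vector set \<Rightarrow> 'a \<Rightarrow> 'a \<Rightarrow> bool" where
  "best_coapproximation Y x y\<^sub>0 \<longleftrightarrow> y\<^sub>0 \<in> Y \<and> (\<forall>y\<in>Y. norm (y\<^sub>0 - y) \<le> norm (x - y))"

definition anti_coproximinal :: "'a::real_normed_vector set \<Rightarrow> bool" where
  "anti_coproximinal Y \<longleftrightarrow> (\<forall>x. x \<notin> Y \<longrightarrow> (\<nexists>y\<^sub>0. best_coapproximation Y x y\<^sub>0))"

end

theory Submission
  imports Defs
begin

text \<open>
  Call a vector \<open>z\<close> annihilated if every functional in \<open>\<J>\<^sub>Y\<close>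
  (the set \<^const>\<open>smooth_support_functionals\<close>) vanishes at \<open>z\<close>.  The weak* closure of
  the span of \<open>\<J>\<^sub>Y\<close> is the whole dual exactly when \<open>0\<close> is the only annihilated vector
  (lemma \<open>weak_star_dense_span_iff\<close>): the functionals vanishing at \<open>z\<close> form a weak*-closed
  subspace, and conversely a functional that vanishes at all annihilated vectors is, on every
  finite set, interpolated by a member of the span (lemma \<open>finite_interpolation\<close>).

  On the other hand, a point \<open>y\<^sub>0\<close> of \<open>Y\<close> is a best coapproximation to \<open>x\<close> out of \<open>Y\<close> precisely when
  \<open>z = x - y\<^sub>0\<close> satisfies \<open>\<parallel>u\<parallel> \<le> \<parallel>u + z\<parallel>\<close> for all \<open>u \<in> Y\<close>.  Since \<open>Y\<close> is a subspace, this means that each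
  \<open>u \<in> Y\<close> is Birkhoff-James orthogonal to \<open>z\<close>.  By the Hahn-Banach theorem each nonzero \<open>u \<in> Y\<close> has a
  support functional that vanishes at \<open>z\<close> (lemma \<open>support_functional_vanishing\<close>); if \<open>u\<close> is
  smooth, this is its only support functional.  So such a \<open>z\<close> is annihilated.  In the other
  direction, if \<open>z\<close> is annihilated and \<open>f\<close> supports the smooth point \<open>u \<in> Y\<close>, then
  \<open>\<parallel>u\<parallel> = \<bar>f u\<bar> = \<bar>f (u + z)\<bar> \<le> \<parallel>u + z\<parallel>\<close>, and this inequality extends to all of \<open>Y\<close> when
  the smooth points in \<open>Y\<close> are dense in \<open>Y\<close>.  Then \<open>0\<close> is a best coapproximation to \<open>z\<close>; if \<open>Y\<close> is
  anti-coproximinal, this puts \<open>z\<close> into \<open>Y\<close>, and the choice \<open>u = - z\<close> gives \<open>z = 0\<close>.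
\<close>

section \<open>Sublinear functionals and the Hahn-Banach theorem\<close>

text \<open>A sublinear functional: real-valued, subadditive and positively homogeneous.\<close>

definition sublinear :: "('a::real_vector \<Rightarrow> real) \<Rightarrow> bool" where
  "sublinear q \<longleftrightarrow> (\<forall>x y. q (x + y) \<le> q x + q y) \<and> (\<forall>t\<ge>0. \<forall>x. q (t *\<^sub>R x) = t * q x)"

lemma sublinear_add: "sublinear q \<Longrightarrow> q (x + y) \<le> q x + q y"
  and sublinear_scale: "sublinear q \<Longrightarrow> 0 \<le> t \<Longrightarrow> q (t *\<^sub>R x) = t * q x"
  by (auto simp: sublinear_def)

lemma sublinear_zero: "sublinear q \<Longrightarrow> q 0 = 0"
  using sublinear_scale[of q 0 0] by simp

lemma sublinear_minus: "sublinear q \<Longrightarrow> - q (- x) \<le> q x"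
  using sublinear_add[of q x "- x"] by (simp add: sublinear_zero)

lemma sublinearI:
  assumes add: "\<And>x y. q (x + y) \<le> q x + q y"
    and scale: "\<And>t x. 0 < t \<Longrightarrow> q (t *\<^sub>R x) \<le> t * q x"
    and zero: "q 0 = 0"
  shows "sublinear q"
  unfolding sublinear_def
proof (intro conjI allI impI)
  fix t :: real and x assume "0 \<le> t"
  show "q (t *\<^sub>R x) = t * q x"
  proof (cases "t = 0")
    case False
    with \<open>0 \<le> t\<close> have t: "0 < t" by simp
    have "q x \<le> inverse t * q (t *\<^sub>R x)"
      using scale[of "inverse t" "t *\<^sub>R x"] t by simp
    with t have "t * q x \<le> q (t *\<^sub>R x)" by (simp add: field_simps)
    with scale[OF t] show ?thesis by (simp add: antisym)
  qed (simp add: zero)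
qed (fact add)

text \<open>
  Given an additive, positively homogeneous minorant \<open>h\<close> of \<open>q\<close> on a convex cone \<open>C\<close>, the
  following is the largest sublinear functional \<open>r \<le> q\<close> with \<open>r (- w) \<le> - h w\<close> on \<open>C\<close>.  Thus
  every linear functional below it dominates \<open>h\<close> on \<open>C\<close>.
\<close>

lemma sublinear_cone_infimum:
  fixes q h :: "'a::real_vector \<Rightarrow> real"
  assumes q: "sublinear q" and C0: "0 \<in> C"
    and Cadd: "\<And>v w. v \<in> C \<Longrightarrow> w \<in> C \<Longrightarrow> v + w \<in> C"
    and Cscale: "\<And>t w. 0 < t \<Longrightarrow> w \<in> C \<Longrightarrow> t *\<^sub>R w \<in> C"
    and hadd: "\<And>v w. v \<in> C \<Longrightarrow> w \<in> C \<Longrightarrow> h (v + w) = h v + h w"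
    and hscale: "\<And>t w. 0 < t \<Longrightarrow> w \<in> C \<Longrightarrow> h (t *\<^sub>R w) = t * h w"
    and hq: "\<And>w. w \<in> C \<Longrightarrow> h w \<le> q w"
  defines "r \<equiv> \<lambda>x. INF w\<in>C. q (x + w) - h w"
  shows "sublinear r" and "\<And>x w. w \<in> C \<Longrightarrow> r x \<le> q (x + w) - h w"
    and "\<And>x. r x \<le> q x"
proof -
  have lower: "- q (- x) \<le> q (x + w) - h w" if "w \<in> C" for x w
    using sublinear_add[OF q, of "x + w" "- x"] hq[OF that] by simp
  have upper: "r x \<le> q (x + w) - h w" if "w \<in> C" for x w
    unfolding r_def by (rule cINF_lower[OF _ that], rule bdd_belowI2[OF lower])
  have greatest: "b \<le> r x" if "\<And>w. w \<in> C \<Longrightarrow> b \<le> q (x + w) - h w" for b x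
    unfolding r_def using C0 that by (intro cINF_greatest) auto
  have h0: "h 0 = 0" using hadd[OF C0 C0] by simp
  show below: "r x \<le> q x" for x
    using upper[OF C0, of x] h0 by simp
  show "r x \<le> q (x + w) - h w" if "w \<in> C" for x w
    by (fact upper[OF that])
  show "sublinear r"
  proof (rule sublinearI)
    fix x y
    have *: "r (x + y) \<le> (q (x + v) - h v) + (q (y + w) - h w)" if "v \<in> C" "w \<in> C" for v w
      using upper[OF Cadd[OF that], of "x + y"] hadd[OF that]
        sublinear_add[OF q, of "x + v" "y + w"] by (simp add: algebra_simps)
    have "r (x + y) - (q (x + v) - h v) \<le> r y" if "v \<in> C" for v
      by (rule greatest) (use *[OF that] in force)
    then have "r (x + y) - r y \<le> r x"
      by (intro greatest) force
    then show "r (x + y) \<le> r x + r y" by simp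
  next
    fix t :: real and x assume t: "0 < t"
    have "r (t *\<^sub>R x) / t \<le> r x"
    proof (rule greatest)
      fix w assume w: "w \<in> C"
      have "r (t *\<^sub>R x) \<le> t * (q (x + w) - h w)"
        using upper[OF Cscale[OF t w], of "t *\<^sub>R x"] t sublinear_scale[OF q, of t "x + w"]
          hscale[OF t w]
        by (simp add: algebra_simps)
      then show "r (t *\<^sub>R x) / t \<le> q (x + w) - h w" using t by (simp add: field_simps)
    qed
    then show "r (t *\<^sub>R x) \<le> t * r x" using t by (simp add: field_simps)
  next
    have "- q (- 0) \<le> r 0" by (rule greatest) (rule lower)
    with below[of 0] show "r 0 = 0" by (simp add: sublinear_zero[OF q])
  qed
qed

text \<open>The case of a single ray, on which a sublinear functional is itself additive.\<close>

lemma sublinear_ray_infimum: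
  fixes q :: "'a::real_vector \<Rightarrow> real"
  assumes q: "sublinear q"
  shows "\<exists>r. sublinear r \<and> (\<forall>x. r x \<le> q x) \<and> r (- u) \<le> - q u"
proof -
  let ?C = "{t *\<^sub>R u | t. 0 \<le> t}"
  let ?r = "\<lambda>x. INF w\<in>?C. q (x + w) - q w"
  have add: "s *\<^sub>R u + t *\<^sub>R u = (s + t) *\<^sub>R u" for s t
    by (simp add: scaleR_left_distrib)
  have 1: "0 \<in> ?C" by force
  have 2: "v + w \<in> ?C" if "v \<in> ?C" "w \<in> ?C" for v w
  proof -
    from that obtain s t where "v = s *\<^sub>R u" "0 \<le> s" "w = t *\<^sub>R u" "0 \<le> t" by blast
    then show ?thesis using add by (auto intro!: exI[of _ "s + t"])
  qed
  have 3: "t *\<^sub>R w \<in> ?C" if "0 < t" "w \<in> ?C" for t w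
  proof -
    from that obtain s where "w = s *\<^sub>R u" "0 \<le> s" by blast
    then show ?thesis using that(1) by (auto intro!: exI[of _ "t * s"])
  qed
  have 4: "q (v + w) = q v + q w" if "v \<in> ?C" "w \<in> ?C" for v w
    using that by (auto simp: add sublinear_scale[OF q] distrib_right)
  have 5: "q (t *\<^sub>R w) = t * q w" if "0 < t" for t w
    using that by (simp add: sublinear_scale[OF q])
  have r: "sublinear ?r" "\<And>x w. w \<in> ?C \<Longrightarrow> ?r x \<le> q (x + w) - q w" "\<And>x. ?r x \<le> q x"
    by (rule sublinear_cone_infimum[where q = q and h = q and C = ?C, OF q 1];
        (assumption | rule 2 3 4 5 order_refl)+)+
  have "u \<in> ?C" by (auto intro: exI[of _ 1])
  then have "?r (- u) \<le> q (- u + u) - q u" by (rule r(2))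
  then have "?r (- u) \<le> - q u" by (simp add: sublinear_zero[OF q])
  with r(1,3) show ?thesis by blast
qed

text \<open>
  Minimality is taken with respect to the pointwise order.  It forces equality with the ray
  infimum, so that the functional is odd, and an odd sublinear functional is linear.
\<close>

lemma linear_of_minimal_sublinear:
  fixes m :: "'a::real_vector \<Rightarrow> real"
  assumes m: "sublinear m"
    and minimal: "\<And>r. sublinear r \<Longrightarrow> (\<And>x. r x \<le> m x) \<Longrightarrow> r = m"
  shows "linear m"
proof -
  have neg: "m (- y) = - m y" for y
  proof -
    obtain r where "sublinear r" "\<And>x. r x \<le> m x" "r (- y) \<le> - m y"
      using sublinear_ray_infimum[OF m] by blast
    with minimal have "m (- y) \<le> - m y" by metis
    with sublinear_minus[OF m, of y] show ?thesis by simp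
  qed
  have add: "m (x + y) = m x + m y" for x y
    using sublinear_add[OF m, of x y] sublinear_add[OF m, of "x + y" "- y"] neg[of y] by simp
  have "m (t *\<^sub>R x) = t * m x" for t x
  proof (cases "0 \<le> t")
    case False
    then have "m ((- t) *\<^sub>R x) = - t * m x" by (simp only: sublinear_scale[OF m])
    then show ?thesis using neg[of "t *\<^sub>R x"] by simp
  qed (rule sublinear_scale[OF m])
  with add show ?thesis by (intro linearI) auto
qed

lemma exists_linear_below_sublinear:
  fixes q :: "'a::real_vector \<Rightarrow> real"
  assumes q: "sublinear q"
  shows "\<exists>g. linear g \<and> (\<forall>x. g x \<le> q x)"
proof -
  let ?A = "{r. sublinear r \<and> (\<forall>x. r x \<le> q x)}"
  let ?P = "\<lambda>r s. \<forall>x. s x \<le> (r x :: real)"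
  have "\<exists>m\<in>?A. \<forall>a\<in>?A. ?P m a \<longrightarrow> a = m"
  proof (rule predicate_Zorn)
    show "partial_order_on ?A (relation_of ?P ?A)"
      by (rule partial_order_on_relation_ofI) (auto intro: order_trans simp: fun_eq_iff antisym)
  next
    fix C assume "C \<in> Chains (relation_of ?P ?A)"
    then have chain: "\<And>r s. r \<in> C \<Longrightarrow> s \<in> C \<Longrightarrow> ?P r s \<or> ?P s r" and CA: "C \<subseteq> ?A"
      by (auto simp: Chains_def relation_of_def)
    show "\<exists>u\<in>?A. \<forall>a\<in>C. ?P a u"
    proof (cases "C = {}")
      case True
      with q show ?thesis by auto
    next
      case False
      let ?u = "\<lambda>x. INF r\<in>C. r x"
      have lower: "- q (- x) \<le> r x" if "r \<in> C" for r x
        using sublinear_minus[of r x] that CA by (smt (verit) mem_Collect_eq subset_iff)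
      have upper: "?u x \<le> r x" if "r \<in> C" for r x
        by (rule cINF_lower[OF _ that], rule bdd_belowI2[OF lower])
      have greatest: "b \<le> ?u x" if "\<And>r. r \<in> C \<Longrightarrow> b \<le> r x" for b x
        using False that by (intro cINF_greatest)
      have "sublinear ?u"
      proof (rule sublinearI)
        fix x y
        have *: "?u (x + y) \<le> r x + s y" if rs: "r \<in> C" "s \<in> C" for r s
        proof -
          \<comment> \<open>in a chain one of the two functionals is below the other at both points\<close>
          obtain p where p: "p \<in> C" "p x \<le> r x" "p y \<le> s y"
            using chain[OF rs] rs by auto
          have "p (x + y) \<le> p x + p y" using p(1) CA sublinear_add by blast
          with upper[OF p(1), of "x + y"] p show ?thesis by linarith
        qed
        have "?u (x + y) - r x \<le> ?u y" if "r \<in> C" for r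
          by (rule greatest) (use *[OF that] in force)
        then have "?u (x + y) - ?u y \<le> ?u x"
          by (intro greatest) force
        then show "?u (x + y) \<le> ?u x + ?u y" by simp
      next
        fix t :: real and x assume t: "0 < t"
        have "?u (t *\<^sub>R x) / t \<le> ?u x"
        proof (rule greatest)
          fix r assume r: "r \<in> C"
          then have "r (t *\<^sub>R x) = t * r x" using CA t sublinear_scale[of r t x] by auto
          with upper[OF r, of "t *\<^sub>R x"] t show "?u (t *\<^sub>R x) / t \<le> r x"
            by (simp add: field_simps)
        qed
        then show "?u (t *\<^sub>R x) \<le> t * ?u x" using t by (simp add: field_simps)
      next
        have "r 0 = 0" if "r \<in> C" for r using that CA sublinear_zero by blast
        then have "?u 0 = (INF r\<in>C. 0)" by (intro INF_cong) auto
        with False show "?u 0 = 0" by simp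
      qed
      moreover have "?u x \<le> q x" for x
        using False upper CA by (metis (mono_tags, lifting) equals0I mem_Collect_eq order_trans subset_iff)
      ultimately show ?thesis using upper by (intro bexI[of _ ?u]) auto
    qed
  qed
  then obtain m where m: "sublinear m" "\<And>x. m x \<le> q x"
    and minimal: "\<And>r. sublinear r \<Longrightarrow> (\<And>x. r x \<le> q x) \<Longrightarrow> (\<And>x. r x \<le> m x) \<Longrightarrow> r = m"
    by auto
  have "linear m"
    by (rule linear_of_minimal_sublinear[OF m(1)]) (meson minimal m(2) order_trans)
  with m(2) show ?thesis by blast
qed

text \<open>
  The Hahn-Banach theorem in the form used below: a linear functional dominated by \<open>q\<close> that
  touches it at a prescribed point.
\<close>

lemma exists_linear_below_sublinear_eq_at:
  fixes q :: "'a::real_vector \<Rightarrow> real"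
  assumes q: "sublinear q"
  shows "\<exists>g. linear g \<and> (\<forall>x. g x \<le> q x) \<and> g u = q u"
proof -
  obtain r where r: "sublinear r" "\<And>x. r x \<le> q x" "r (- u) \<le> - q u"
    using sublinear_ray_infimum[OF q] by blast
  obtain g where g: "linear g" "\<And>x. g x \<le> r x"
    using exists_linear_below_sublinear[OF r(1)] by blast
  have "q u \<le> g u"
    using g(2)[of "- u"] r(3) by (simp add: linear_neg[OF g(1)])
  with g r(2) show ?thesis by (meson order_trans antisym)
qed

section \<open>Support functionals over the scalar field\<close>

text \<open>
  In the complex case \<open>f x = g x - \<i> g (\<i> x)\<close> is the scalar-linear functional with real part
  \<open>g\<close>; multiplying the argument by a suitable unimodular scalar transfers the bound to \<open>f\<close>.
\<close>

lemma (in normed_space_over) dual_functional_of_real_linear: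
  assumes g: "linear g" and le: "\<And>x. g x \<le> norm x"
  shows "\<exists>f\<in>dual_space smul. (\<forall>x. norm (f x) \<le> norm x) \<and>
    (\<forall>x. g x = norm x \<longrightarrow> f x = of_real (norm x)) \<and>
    (\<forall>x. (\<forall>c. g (smul c x) = 0) \<longrightarrow> f x = 0)"
proof -
  have gr: "g (smul (of_real r) x) = r * g x" for r x
    by (simp add: scale_of_real linear_scale[OF g])
  have dual: "f \<in> dual_space smul"
    if add: "\<And>x y. f (x + y) = f x + f y" and scale: "\<And>c x. f (smul c x) = c * f x"
      and bound: "\<And>x. norm (f x) \<le> norm x" for f :: "'a \<Rightarrow> 'k"
  proof -
    interpret sc: vector_space "(*) :: 'k \<Rightarrow> 'k \<Rightarrow> 'k"
      by unfold_locales (simp_all add: algebra_simps)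
    have "Vector_Spaces.linear smul (*) f"
      by unfold_locales (simp_all add: add scale)
    moreover have "bounded_linear f"
      by (rule bounded_linear_intro[where K = 1])
        (use add scale[of "of_real _"] bound in \<open>simp_all add: scale_of_real scaleR_conv_of_real\<close>)
    ultimately show ?thesis by (simp add: dual_space_def)
  qed
  consider (real) "\<forall>z::'k. \<exists>a. z = a *\<^sub>R 1"
    | (complex) i :: 'k where "i * i = - 1"
        "\<And>z::'k. \<exists>a b. z = a *\<^sub>R 1 + b *\<^sub>R i \<and> norm z = sqrt (a\<^sup>2 + b\<^sup>2)"
    using real_or_complex by metis
  then show ?thesis
  proof cases
    case real
    let ?f = "\<lambda>x. of_real (g x) :: 'k"
    have scalar: "\<exists>a. c = of_real a" for c :: 'k
      using real by (metis of_real_def)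
    have "\<bar>g x\<bar> \<le> norm x" for x
      using le[of x] le[of "- x"] by (simp add: linear_neg[OF g])
    moreover have "?f (smul c x) = c * ?f x" for c x
      using scalar[of c] gr by auto
    ultimately have "?f \<in> dual_space smul"
      by (intro dual) (simp_all add: linear_add[OF g])
    moreover have "g x = 0" if "\<forall>c. g (smul c x) = 0" for x
      using that[rule_format, of 1] by simp
    ultimately show ?thesis
      using \<open>\<And>x. \<bar>g x\<bar> \<le> norm x\<close> by (intro bexI[of _ ?f]) auto
  next
    case complex
    have rep: "\<exists>a b. z = of_real a + of_real b * i \<and> norm z = sqrt (a\<^sup>2 + b\<^sup>2)" for z :: 'k
      using complex(2)[of z] by (simp add: scaleR_conv_of_real)
    have indep: "a = 0 \<and> b = 0" if "of_real a + of_real b * i = 0" for a b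
    proof -
      have "of_real a * of_real a = (of_real b * i) * (of_real b * i)"
        using that by (simp add: add_eq_0_iff)
      also have "\<dots> = - (of_real b * of_real b)"
        using complex(1) by (metis mult.assoc mult.commute mult_minus1_right)
      finally have "of_real (a * a + b * b) = (0 :: 'k)" by simp
      then have "a * a + b * b = 0" by (simp only: of_real_eq_0_iff)
      then show ?thesis by (simp add: sum_squares_eq_zero_iff)
    qed
    have unique: "a = a' \<and> b = b'"
      if "of_real a + of_real b * i = of_real a' + of_real b' * i" for a b a' b'
      using indep[of "a - a'" "b - b'"] that by (simp add: algebra_simps)
    have norm: "norm (of_real a + of_real b * i) = sqrt (a\<^sup>2 + b\<^sup>2)" for a b
      using rep[of "of_real a + of_real b * i"] unique by metis
    define f where "f x = of_real (g x) - of_real (g (smul i x)) * i" for x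
    have add: "f (x + y) = f x + f y" for x y
      by (simp add: f_def linear_add[OF g] scale_right_distrib algebra_simps)
    have fr: "f (smul (of_real r) x) = of_real r * f x" for r x
    proof -
      have "g (smul i (smul (of_real r) x)) = g (smul (of_real r) (smul i x))"
        by (simp add: mult.commute)
      then show ?thesis by (simp add: f_def gr algebra_simps del: scale_scale)
    qed
    have fi: "f (smul i x) = i * f x" for x
    proof -
      have "i * (t * i) = - t" for t
        using mult.left_commute[of i t i] by (simp add: complex(1))
      then show ?thesis
        by (simp add: f_def complex(1) linear_neg[OF g] right_diff_distrib
            mult.commute[of i "of_real (g x)"])
    qed
    have scale: "f (smul c x) = c * f x" for c x
    proof -
      obtain a b where c: "c = of_real a + of_real b * i" using rep[of c] by blast
      have "smul c x = smul (of_real a) x + smul (of_real b) (smul i x)"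
        by (simp add: c scale_left_distrib)
      then have "f (smul c x) = of_real a * f x + of_real b * (i * f x)"
        by (simp only: add fr fi)
      then show ?thesis by (simp add: c algebra_simps)
    qed
    have bound: "norm (f x) \<le> norm x" for x
    proof (cases "f x = 0")
      case False
      let ?c = "of_real (norm (f x)) / f x"
      have "f (smul ?c x) = of_real (norm (f x))" using False by (simp add: scale)
      then have "of_real (g (smul ?c x)) + of_real (- g (smul i (smul ?c x))) * i
          = of_real (norm (f x)) + of_real 0 * i"
        by (simp only: f_def) simp
      then have "norm (f x) = g (smul ?c x)" using unique by metis
      also have "\<dots> \<le> norm (smul ?c x)" by (rule le)
      also have "\<dots> = norm x" using False by (simp add: norm_scale norm_divide)
      finally show ?thesis .
    qed simp
    have "f x = of_real (norm x)" if gx: "g x = norm x" for x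
    proof -
      have "norm (f x) = sqrt ((norm x)\<^sup>2 + (g (smul i x))\<^sup>2)"
        using norm[of "norm x" "- g (smul i x)"] by (simp add: f_def gx)
      with bound[of x] have "sqrt ((norm x)\<^sup>2 + (g (smul i x))\<^sup>2) \<le> norm x" by simp
      then have "(norm x)\<^sup>2 + (g (smul i x))\<^sup>2 \<le> (norm x)\<^sup>2"
        by (rule sqrt_le_D)
      then have "g (smul i x) = 0" by simp
      then show ?thesis by (simp add: f_def gx)
    qed
    moreover have "f x = 0" if "\<forall>c. g (smul c x) = 0" for x
      using that that[rule_format, of 1] by (simp add: f_def)
    ultimately show ?thesis using dual[OF add scale bound] bound by blast
  qed
qed

lemma (in normed_space_over) support_functionalI:
  assumes f: "f \<in> dual_space smul" and le: "\<And>x. norm (f x) \<le> norm x"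
    and u: "u \<noteq> 0" "f u = of_real (norm u)"
  shows "f \<in> support_functionals smul u"
proof -
  have bl: "bounded_linear f" using f by (simp add: dual_space_def)
  have "onorm f \<le> 1" by (rule onorm_bound) (simp_all add: le)
  moreover have "norm (f u) \<le> onorm f * norm u" by (rule onorm[OF bl])
  then have "1 \<le> onorm f" using u by simp
  ultimately show ?thesis
    using f u by (simp add: support_functionals_def dual_sphere_def)
qed

text \<open>
  The Hahn-Banach direction of James' characterization of Birkhoff-James orthogonality of \<open>u\<close> to \<open>z\<close>.  With \<open>z = 0\<close> it says
  that every nonzero vector has a support functional.
\<close>

lemma (in normed_space_over) support_functional_vanishing:
  assumes u: "u \<noteq> 0" and orth: "\<And>c. norm u \<le> norm (u + smul c z)"
  shows "\<exists>f\<in>support_functionals smul u. f z = 0"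
proof -
  let ?C = "range (\<lambda>c. smul c z)"
  \<comment> \<open>the distance from the line through \<open>z\<close>; orthogonality says that \<open>?q u = norm u\<close>\<close>
  let ?q = "\<lambda>x. INF w\<in>?C. norm (x + w) - 0"
  have 0: "sublinear (norm :: 'a \<Rightarrow> real)"
    by (simp add: sublinear_def norm_triangle_ineq)
  have 1: "0 \<in> ?C" by (rule range_eqI[of _ _ 0]) simp
  have 2: "v + w \<in> ?C" if "v \<in> ?C" "w \<in> ?C" for v w
    using that by (auto simp flip: scale_left_distrib)
  have 3: "t *\<^sub>R w \<in> ?C" if "w \<in> ?C" for t w
    using that by (auto simp flip: scale_of_real)
  note q = sublinear_cone_infimum[where q = norm and h = "\<lambda>_. 0" and C = ?C, OF 0 1 2 3]
  have q': "sublinear ?q" "\<And>x w. w \<in> ?C \<Longrightarrow> ?q x \<le> norm (x + w) - 0" "\<And>x. ?q x \<le> norm x"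
    by (rule q; simp)+
  have qu: "?q u = norm u"
    by (rule antisym[OF q'(3)], rule cINF_greatest) (use orth in auto)
  obtain g where g: "linear g" "\<And>x. g x \<le> ?q x" "g u = ?q u"
    using exists_linear_below_sublinear_eq_at[OF q'(1)] by blast
  have le: "g x \<le> norm x" for x
    using g(2) q'(3) order_trans by blast
  have nonpos: "g (smul c z) \<le> 0" for c
  proof -
    have "?q (smul c z) \<le> norm (smul c z + smul (- c) z) - 0"
      by (rule q'(2)) (rule rangeI)
    also have "\<dots> = 0" by simp
    finally show ?thesis using g(2) order_trans by blast
  qed
  have "g (smul c z) = 0" for c
    using nonpos[of c] nonpos[of "- c"] by (simp add: linear_neg[OF g(1)])
  then obtain f where "f \<in> dual_space smul" "\<And>x. norm (f x) \<le> norm x"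
      "f u = of_real (norm u)" "f z = 0"
    using dual_functional_of_real_linear[OF g(1) le] g(3) qu by metis
  then show ?thesis using support_functionalI[OF _ _ u] by blast
qed

section \<open>Weak* density of a span\<close>

lemma vector_space_functions: "vector_space (\<lambda>c f x. c * f x :: 'k::field)"
  by unfold_locales (simp_all add: fun_eq_iff algebra_simps)

text \<open>
  If a function \<open>f\<close> satisfies every linear relation between values at points of a finite set
  \<open>F\<close> that holds throughout a linear space \<open>W\<close> of functions, then it agrees on \<open>F\<close> with a
  member of \<open>W\<close>.
\<close>

lemma finite_interpolation:
  fixes W :: "('a \<Rightarrow> 'k::field) set" and f :: "'a \<Rightarrow> 'k"
  assumes W: "module.subspace (\<lambda>c f x. c * f x) W" and F: "finite F"
    and relations: "\<And>c. (\<And>g. g \<in> W \<Longrightarrow> (\<Sum>x\<in>F. c x * g x) = 0) \<Longrightarrow> (\<Sum>x\<in>F. c x * f x) = 0"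
  shows "\<exists>g\<in>W. \<forall>x\<in>F. g x = f x"
proof (rule ccontr)
  assume none: "\<not> ?thesis"
  let ?s = "\<lambda>c (f :: 'a \<Rightarrow> 'k) x. c * f x"
  interpret fs: vector_space ?s by (rule vector_space_functions)
  interpret sc: vector_space "(*) :: 'k \<Rightarrow> 'k \<Rightarrow> 'k"
    by unfold_locales (simp_all add: algebra_simps)
  interpret vp: vector_space_pair ?s "(*) :: 'k \<Rightarrow> 'k \<Rightarrow> 'k" ..
  \<comment> \<open>restriction to \<open>F\<close>, with values \<open>0\<close> outside\<close>
  define R :: "('a \<Rightarrow> 'k) \<Rightarrow> 'a \<Rightarrow> 'k" where "R h = (\<lambda>x. if x \<in> F then h x else 0)" for h
  have "fs.subspace (R ` W)"
  proof (rule fs.subspaceI)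
    show "0 \<in> R ` W"
      by (rule image_eqI[OF _ fs.subspace_0[OF W]]) (simp add: R_def fun_eq_iff)
    show "v + w \<in> R ` W" if "v \<in> R ` W" "w \<in> R ` W" for v w
    proof -
      from that obtain g h where "v = R g" "w = R h" "g \<in> W" "h \<in> W" by blast
      then have "v + w = R (g + h)" "g + h \<in> W"
        using fs.subspace_add[OF W] by (auto simp: R_def fun_eq_iff)
      then show ?thesis by blast
    qed
    show "?s c v \<in> R ` W" if "v \<in> R ` W" for c v
    proof -
      from that obtain g where "v = R g" "g \<in> W" by blast
      then have "?s c v = R (?s c g)" "?s c g \<in> W"
        using fs.subspace_scale[OF W] by (auto simp: R_def fun_eq_iff)
      then show ?thesis by blast
    qed
  qed
  moreover obtain B where B: "B \<subseteq> R ` W" "fs.independent B" "R ` W \<subseteq> fs.span B"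
    using fs.maximal_independent_subset .
  ultimately have span: "fs.span B = R ` W"
    by (intro equalityI fs.span_minimal)
  have notin: "R f \<notin> R ` W"
  proof
    assume "R f \<in> R ` W"
    then obtain g where "g \<in> W" "R f = R g" by blast
    then have "\<forall>x\<in>F. g x = f x" by (metis R_def)
    with \<open>g \<in> W\<close> none show False by blast
  qed
  have "fs.independent (insert (R f) B)"
    using B notin span by (simp add: fs.independent_insert)
  then obtain \<phi> where lin: "Vector_Spaces.linear ?s (*) \<phi>"
    and \<phi>: "\<forall>h\<in>insert (R f) B. \<phi> h = (if h = R f then 1 else 0)"
    using vp.linear_independent_extend[where f = "\<lambda>h. if h = R f then 1 else 0"] by blast
  interpret \<phi>: Vector_Spaces.linear ?s "(*) :: 'k \<Rightarrow> 'k \<Rightarrow> 'k" \<phi> by (fact lin)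
  have "\<phi> h = 0" if "h \<in> B" for h
    using \<phi> that B(1) notin by auto
  then have vanish: "\<phi> (R g) = 0" if "g \<in> W" for g
    using that \<phi>.eq_0_on_span[of B "R g"] span by blast
  \<comment> \<open>the coefficients of \<open>\<phi>\<close> form a relation on \<open>F\<close> that holds in \<open>W\<close> but not for \<open>f\<close>\<close>
  define c where "c x = \<phi> (\<lambda>y. if y = x then 1 else 0)" for x
  have expand: "\<phi> (R h) = (\<Sum>x\<in>F. c x * h x)" for h
  proof -
    have sum_apply: "(\<Sum>x\<in>G. k x) y = (\<Sum>x\<in>G. k x y)" if "finite G"
      for G and k :: "'a \<Rightarrow> 'a \<Rightarrow> 'k" and y
      using that by induction auto
    have "R h = (\<Sum>x\<in>F. ?s (h x) (\<lambda>y. if y = x then 1 else 0))"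
      using F by (simp add: fun_eq_iff R_def sum_apply if_distrib cong: if_cong)
    then have "\<phi> (R h) = (\<Sum>x\<in>F. h x * c x)"
      by (simp only: \<phi>.sum \<phi>.scale c_def)
    then show ?thesis by (simp add: mult.commute)
  qed
  have "(\<Sum>x\<in>F. c x * f x) = 0"
    by (rule relations) (simp add: vanish flip: expand)
  then show False using \<phi> expand[of f] by simp
qed

lemma (in normed_space_over) linear_combination_dual:
  assumes "f \<in> dual_space smul"
  shows "f (\<Sum>x\<in>F. smul (c x) x) = (\<Sum>x\<in>F. c x * f x)"
proof -
  interpret f: Vector_Spaces.linear smul "(*)" f
    using assms by (simp add: dual_space_def)
  show ?thesis by (simp add: f.sum f.scale)
qed

lemma (in normed_space_over) subspace_dual_space:
  "module.subspace (\<lambda>c f x. c * f x) (dual_space smul)"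
proof -
  interpret fs: vector_space "\<lambda>c (f :: 'a \<Rightarrow> 'k) x. c * f x" by (rule vector_space_functions)
  interpret sc: vector_space "(*) :: 'k \<Rightarrow> 'k \<Rightarrow> 'k"
    by unfold_locales (simp_all add: algebra_simps)
  interpret vp: vector_space_pair smul "(*) :: 'k \<Rightarrow> 'k \<Rightarrow> 'k" ..
  show ?thesis
  proof (rule fs.subspaceI)
    show "0 \<in> dual_space smul"
      using vp.linear_zero by (simp add: dual_space_def zero_fun_def)
    show "f + g \<in> dual_space smul" if "f \<in> dual_space smul" "g \<in> dual_space smul" for f g
      using that vp.linear_compose_add[of f g] bounded_linear_add[of f g]
      by (simp add: dual_space_def plus_fun_def)
    show "(\<lambda>x. c * f x) \<in> dual_space smul" if "f \<in> dual_space smul" for c f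
      using that vp.linear_compose_scale_right[of f c] bounded_linear_mult_right
        bounded_linear_compose
      by (auto simp: dual_space_def)
  qed
qed

lemma (in normed_space_over) weak_star_dense_span_iff:
  assumes S: "S \<subseteq> dual_space smul"
  shows "weak_star_topology smul closure_of dual_span S = dual_space smul \<longleftrightarrow>
    (\<forall>z. (\<forall>f\<in>S. f z = 0) \<longrightarrow> z = 0)"
    (is "?T closure_of _ = ?D \<longleftrightarrow> _")
proof
  interpret fs: vector_space "\<lambda>c (f :: 'a \<Rightarrow> 'k) x. c * f x" by (rule vector_space_functions)
  have topspace: "topspace ?T = ?D"
    by (simp add: weak_star_topology_def)
  have span_dual: "dual_span S \<subseteq> ?D"
    unfolding dual_span_def by (rule fs.span_minimal[OF S subspace_dual_space])
  have span_vanish: "f z = 0" if "f \<in> dual_span S" "\<forall>f\<in>S. f z = 0" for f z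
    using that(1) unfolding dual_span_def
    by (induction rule: fs.span_induct_alt) (use that(2) in auto)
  {
    assume dense: "?T closure_of dual_span S = ?D"
    show "\<forall>z. (\<forall>f\<in>S. f z = 0) \<longrightarrow> z = 0"
    proof (intro allI impI)
      fix z assume z: "\<forall>f\<in>S. f z = 0"
      have "continuous_map ?T euclidean (\<lambda>f. f z)"
        unfolding weak_star_topology_def
        by (intro continuous_map_from_subtopology continuous_map_product_projection) simp
      then have "closedin ?T {f \<in> topspace ?T. f z \<in> {0}}"
        by (rule closedin_continuous_map_preimage) simp
      then have "?T closure_of dual_span S \<subseteq> {f \<in> topspace ?T. f z \<in> {0}}"
        using span_dual span_vanish z by (intro closure_of_minimal) (auto simp: topspace)
      with dense have vanish: "f z = 0" if "f \<in> ?D" for f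
        using that by blast
      show "z = 0"
      proof (rule ccontr)
        assume "z \<noteq> 0"
        then obtain f where "f \<in> support_functionals smul z"
          using support_functional_vanishing[of z 0] by auto
        then have "f \<in> ?D" "f z = of_real (norm z)"
          by (auto simp: support_functionals_def dual_sphere_def)
        with vanish[of f] \<open>z \<noteq> 0\<close> show False by simp
      qed
    qed
  next
    assume separating: "\<forall>z. (\<forall>f\<in>S. f z = 0) \<longrightarrow> z = 0"
    have "f \<in> ?T closure_of dual_span S" if f: "f \<in> ?D" for f
      unfolding in_closure_of topspace
    proof (intro conjI allI impI)
      fix T assume T: "f \<in> T \<and> openin ?T T"
      then obtain T' where T': "openin (product_topology (\<lambda>_. euclidean) UNIV) T'" "T = T' \<inter> ?D"
        by (auto simp: weak_star_topology_def openin_subtopology)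
      with T obtain U where U: "finite {x. U x \<noteq> UNIV}" "f \<in> Pi\<^sub>E UNIV U" "Pi\<^sub>E UNIV U \<subseteq> T'"
        by (auto simp: openin_product_topology_alt)
      let ?F = "{x. U x \<noteq> UNIV}"
      have "\<exists>g\<in>dual_span S. \<forall>x\<in>?F. g x = f x"
      proof (rule finite_interpolation[OF _ U(1)])
        show "fs.subspace (dual_span S)" by (simp add: dual_span_def)
        fix c assume c: "\<And>g. g \<in> dual_span S \<Longrightarrow> (\<Sum>x\<in>?F. c x * g x) = 0"
        have "g (\<Sum>x\<in>?F. smul (c x) x) = 0" if "g \<in> S" for g
          using c[of g] that S fs.span_base[OF that]
          by (auto simp: linear_combination_dual dual_span_def)
        then have "(\<Sum>x\<in>?F. smul (c x) x) = 0" using separating by blast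
        moreover have "f 0 = 0" using linear_combination_dual[OF f, of _ "{}"] by simp
        ultimately show "(\<Sum>x\<in>?F. c x * f x) = 0"
          using linear_combination_dual[OF f, of c ?F] by simp
      qed
      then obtain g where g: "g \<in> dual_span S" "\<And>x. x \<in> ?F \<Longrightarrow> g x = f x" by blast
      have "g x \<in> U x" for x
        using g(2)[of x] U(2) by (cases "x \<in> ?F") (auto simp: PiE_iff)
      then have "g \<in> T'" using U(3) by (auto simp: PiE_iff)
      with g span_dual T'(2) show "\<exists>g. g \<in> dual_span S \<and> g \<in> T" by blast
    qed (fact f)
    then show "?T closure_of dual_span S = ?D"
      using closure_of_subset_topspace[of ?T "dual_span S"] topspace by blast
  }
qed

section \<open>Coapproximation and annihilated vectors\<close>

lemma (in normed_space_over) best_coapproximation_iff: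
  assumes Y: "subspace Y"
  shows "best_coapproximation Y x y\<^sub>0 \<longleftrightarrow>
    y\<^sub>0 \<in> Y \<and> (\<forall>u\<in>Y. norm u \<le> norm (u + (x - y\<^sub>0)))"
proof (cases "y\<^sub>0 \<in> Y")
  case True
  have "(\<forall>y\<in>Y. norm (y\<^sub>0 - y) \<le> norm (x - y)) \<longleftrightarrow> (\<forall>u\<in>Y. norm u \<le> norm (u + (x - y\<^sub>0)))"
  proof (intro iffI ballI)
    fix u assume "\<forall>y\<in>Y. norm (y\<^sub>0 - y) \<le> norm (x - y)" "u \<in> Y"
    then have "norm (y\<^sub>0 - (y\<^sub>0 - u)) \<le> norm (x - (y\<^sub>0 - u))"
      using subspace_diff[OF Y True] by blast
    then show "norm u \<le> norm (u + (x - y\<^sub>0))" by (simp add: algebra_simps)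
  next
    fix y assume "\<forall>u\<in>Y. norm u \<le> norm (u + (x - y\<^sub>0))" "y \<in> Y"
    then have "norm (y\<^sub>0 - y) \<le> norm ((y\<^sub>0 - y) + (x - y\<^sub>0))"
      using subspace_diff[OF Y True] by blast
    then show "norm (y\<^sub>0 - y) \<le> norm (x - y)" by simp
  qed
  with True show ?thesis by (simp add: best_coapproximation_def)
qed (simp add: best_coapproximation_def)

lemma (in normed_space_over) norm_support_functional_le:
  assumes "f \<in> support_functionals smul u"
  shows "norm (f x) \<le> norm x"
  using onorm[of f x] assms
  by (simp add: support_functionals_def dual_sphere_def dual_space_def)

lemma (in normed_space_over) smooth_support_functional_vanishes:
  assumes Y: "subspace Y" and z: "\<And>u. u \<in> Y \<Longrightarrow> norm u \<le> norm (u + z)"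
    and f: "f \<in> smooth_support_functionals smul Y"
  shows "f z = 0"
proof -
  obtain u where u: "u \<in> smooth_points smul" "norm u = 1" "u \<in> Y" "f u = 1"
    and "f \<in> dual_sphere smul"
    using f by (auto simp: smooth_support_functionals_def)
  then have f: "f \<in> support_functionals smul u"
    by (simp add: support_functionals_def)
  \<comment> \<open>for \<open>c \<noteq> 0\<close> apply the hypothesis on \<open>z\<close> to the vector \<open>smul (inverse c) u\<close> of \<open>Y\<close> and rescale\<close>
  have "norm u \<le> norm (u + smul c z)" for c
  proof (cases "c = 0")
    case False
    have "norm (smul (inverse c) u) \<le> norm (smul (inverse c) u + z)"
      by (rule z) (rule subspace_scale[OF Y u(3)])
    then have "norm (smul c (smul (inverse c) u)) \<le> norm (smul c (smul (inverse c) u + z))"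
      unfolding norm_scale[of c] by (rule mult_left_mono) simp
    then show ?thesis using False by (simp add: scale_right_distrib)
  qed simp
  then obtain g where "g \<in> support_functionals smul u" "g z = 0"
    using support_functional_vanishing[of u z] u(2) by force
  with f u(1) show ?thesis by (auto simp: smooth_points_def)
qed

lemma (in normed_space_over) norm_le_of_annihilated:
  assumes Y: "subspace Y" and z: "\<And>f. f \<in> smooth_support_functionals smul Y \<Longrightarrow> f z = 0"
    and u: "u \<in> smooth_points smul" "u \<in> Y"
  shows "norm u \<le> norm (u + z)"
proof -
  have u0: "u \<noteq> 0" and "\<exists>f. support_functionals smul u = {f}"
    using u(1) by (auto simp: smooth_points_def)
  then obtain f where f: "support_functionals smul u = {f}" by blast
  let ?c = "of_real (inverse (norm u)) :: 'k"
  let ?v = "smul ?c u"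
  have v: "norm ?v = 1" "?v \<in> Y"
    using u0 subspace_scale[OF Y u(2)] by (simp_all add: norm_scale norm_inverse)
  \<comment> \<open>positive multiples have the same support functionals, so smoothness passes to \<open>?v\<close>\<close>
  have "support_functionals smul ?v = support_functionals smul u"
  proof -
    have "h ?v = of_real (norm ?v) \<longleftrightarrow> h u = of_real (norm u)" if "h \<in> dual_sphere smul" for h
    proof -
      have "h (smul ?c u) = ?c * h u"
        using that linear_combination_dual[of h "\<lambda>_. ?c" "{u}"] by (simp add: dual_sphere_def)
      then show ?thesis using u0 v(1) by (auto simp: field_simps)
    qed
    then show ?thesis unfolding support_functionals_def by blast
  qed
  with f v(1) have "?v \<in> smooth_points smul" "f \<in> support_functionals smul ?v"
    by (auto simp: smooth_points_def)
  with v have "f \<in> smooth_support_functionals smul Y"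
    by (auto simp: smooth_support_functionals_def support_functionals_def)
  then have "f z = 0" by (rule z)
  have fu: "f \<in> support_functionals smul u" using f by simp
  then have "linear f" "f u = of_real (norm u)"
    by (auto simp: support_functionals_def dual_sphere_def dual_space_def bounded_linear.linear)
  then have "f (u + z) = of_real (norm u)" using \<open>f z = 0\<close> by (simp add: linear_add)
  with norm_support_functional_le[OF fu, of "u + z"] show ?thesis by simp
qed

theorem proposition3p2:
  fixes smul :: "'k::real_or_complex \<Rightarrow> 'a::banach \<Rightarrow> 'a"
    and Y :: "'a set"
  assumes "normed_space_over smul"
    and "module.subspace smul Y"
    and "closed Y"
    and "Y \<noteq> UNIV"
  shows "(weak_star_topology smul closure_of dual_span (smooth_support_functionals smul Y)
            = dual_space smul \<longrightarrow> anti_coproximinal Y)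
       \<and> (Y \<subseteq> closure (smooth_points smul \<inter> Y) \<longrightarrow>
            (anti_coproximinal Y \<longleftrightarrow>
             weak_star_topology smul closure_of dual_span (smooth_support_functionals smul Y)
               = dual_space smul))"
proof -
  interpret normed_space_over smul by fact
  note Y = \<open>module.subspace smul Y\<close>
  let ?J = "smooth_support_functionals smul Y"
  have "?J \<subseteq> dual_space smul"
    by (auto simp: smooth_support_functionals_def dual_sphere_def)
  note dense_iff = weak_star_dense_span_iff[OF this]
  have sufficient: "anti_coproximinal Y" if "\<forall>z. (\<forall>f\<in>?J. f z = 0) \<longrightarrow> z = 0"
    unfolding anti_coproximinal_def
  proof (intro allI impI notI)
    fix x assume "x \<notin> Y" "\<exists>y\<^sub>0. best_coapproximation Y x y\<^sub>0"
    then obtain y\<^sub>0 where y\<^sub>0: "y\<^sub>0 \<in> Y" "\<And>u. u \<in> Y \<Longrightarrow> norm u \<le> norm (u + (x - y\<^sub>0))"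
      by (auto simp: best_coapproximation_iff[OF Y])
    then have "x - y\<^sub>0 = 0"
      using that smooth_support_functional_vanishes[OF Y] by blast
    with y\<^sub>0(1) \<open>x \<notin> Y\<close> show False by simp
  qed
  have necessary: "z = 0"
    if smooth: "Y \<subseteq> closure (smooth_points smul \<inter> Y)" and anti: "anti_coproximinal Y"
      and z: "\<forall>f\<in>?J. f z = 0" for z
  proof -
    have "closed {u. norm u \<le> norm (u + z)}"
      by (intro closed_Collect_le continuous_intros)
    then have "closure (smooth_points smul \<inter> Y) \<subseteq> {u. norm u \<le> norm (u + z)}"
      using norm_le_of_annihilated[OF Y] z by (intro closure_minimal) auto
    with smooth have le: "norm u \<le> norm (u + z)" if "u \<in> Y" for u
      using that by blast
    then have "best_coapproximation Y z 0"
      by (simp add: best_coapproximation_iff[OF Y] subspace_0[OF Y])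
    with anti have "z \<in> Y" unfolding anti_coproximinal_def by blast
    \<comment> \<open>at \<open>u = - z\<close> the inequality reads \<open>norm z \<le> 0\<close>\<close>
    then have "- z \<in> Y" by (rule subspace_neg[OF Y])
    from le[OF this] show "z = 0" by simp
  qed
  show ?thesis unfolding dense_iff using sufficient necessary by blast
qed

end
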